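(* (Risk-neutral perfectly rational agent: $\lambda\to+\infty$ and $\mu\to0$.) One has $$\lim_{\mu\to0}\frac1\mu\log\sum_{x_2}p_0(x_2|x_1)\exp\big(\mu U(x_2|x_1)\big)=\sum_{x_2}p_0(x_2|x_1)U(x_2|x_1),$$ which is the expected utility. Consequently, setting $U(x_1)\equiv0$ and taking the limit $\lambda\to+\infty$ in the bounded-rational action policy $p(x_1)$ (defined in the context), one obtains an expected utility maximizer $$p(x_1)=\delta(x_1-x_1^* )\qquad\text{with}\qquad x_1^*=\arg\max_{x_1}\sum_{x_2}p_0(x_2|x_1)U(x_2|x_1).$$
   Context: A decision-maker emits an action $x_1$ with default probability $p_0(x_1)$ and then expects an input $x_2$ with default probability $p_0(x_2|x_1)$; $U(x_1)$ and $U(x_2|x_1)$ are real-valued utilities of the two symbols. For parameters $\lambda$ (agent) and $\mu$ (environment), the bounded-rational action policy is $$p(x_1)=\frac{1}{Z_1}\,p_0(x_1)\exp\Big(\lambda\Big(U(x_1)+\tfrac1\mu\log\sum_{x_2}p_0(x_2|x_1)\exp\big(\mu U(x_2|x_1)\big)\Big)\Big),$$ where $Z_1$ is the normalization constant. $\delta(x_1-x_1^* )$ denotes the distribution concentrated at $x_1^*$, i.e. action selection is deterministic.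
   Formalization: The formal theorem takes the arg max over actions with positive default probability p_0(x_1) and assumes that the maximizer there is unique; with ties, or a maximizer with p_0 = 0, the limit policy is not the claimed delta. The sums are over finite alphabets. *)

theory Defs
  imports "HOL-Probability.Probability"
begin

text \<open>Symbols range over finite alphabets: \<open>p1\<close> is the default distribution of the action and
  \<open>p2 x1\<close> that of the input given the action \<open>x1\<close>. An action outside the support of \<open>p1\<close> has
  probability zero under every policy below, so optimal actions are sought in \<open>set_pmf p1\<close>,
  which is the whole alphabet when all default probabilities are positive.\<close>

definition certainty_equivalent ::
  "('a \<Rightarrow> 'b::finite pmf) \<Rightarrow> ('a \<Rightarrow> 'b \<Rightarrow> real) \<Rightarrow> real \<Rightarrow> 'a \<Rightarrow> real" where
  "certainty_equivalent p2 U2 mu x1 =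
     1 / mu * ln (\<Sum>x2\<in>UNIV. pmf (p2 x1) x2 * exp (mu * U2 x1 x2))"

definition expected_utility ::
  "('a \<Rightarrow> 'b::finite pmf) \<Rightarrow> ('a \<Rightarrow> 'b \<Rightarrow> real) \<Rightarrow> 'a \<Rightarrow> real" where
  "expected_utility p2 U2 x1 = (\<Sum>x2\<in>UNIV. pmf (p2 x1) x2 * U2 x1 x2)"

lemma expected_utility_eq_expectation:
  "expected_utility p2 U2 x1 = measure_pmf.expectation (p2 x1) (U2 x1)"
  by (simp add: expected_utility_def integral_measure_pmf[where A = UNIV])

definition gibbs_policy :: "'a::finite pmf \<Rightarrow> real \<Rightarrow> ('a \<Rightarrow> real) \<Rightarrow> 'a \<Rightarrow> real" where
  "gibbs_policy p1 lam V x1 =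
     1 / (\<Sum>y\<in>UNIV. pmf p1 y * exp (lam * V y)) * (pmf p1 x1 * exp (lam * V x1))"

definition bounded_rational_policy ::
  "'a::finite pmf \<Rightarrow> ('a \<Rightarrow> 'b::finite pmf) \<Rightarrow> ('a \<Rightarrow> real) \<Rightarrow> ('a \<Rightarrow> 'b \<Rightarrow> real) \<Rightarrow>
   real \<Rightarrow> real \<Rightarrow> 'a \<Rightarrow> real" where
  "bounded_rational_policy p1 p2 U1 U2 lam mu =
     gibbs_policy p1 lam (\<lambda>x1. U1 x1 + certainty_equivalent p2 U2 mu x1)"

end

theory Submission
  imports Defs
begin

text \<open>The certainty equivalent is the difference quotient at \<open>0\<close> of the cumulant generating function
  of the utility, whose derivative there is the mean. A Gibbs policy does not change when its utility
  is shifted by the value at the optimal action; after that shift every weight other than the optimal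
  one tends to \<open>0\<close>, even if the utility itself varies as long as it converges.\<close>

lemma certainty_equivalent_tendsto_expected_utility:
  "((\<lambda>mu. certainty_equivalent p2 U2 mu x1) \<longlongrightarrow> expected_utility p2 U2 x1) (at 0)"
proof -
  define S where "S mu = (\<Sum>x2\<in>UNIV. pmf (p2 x1) x2 * exp (mu * U2 x1 x2))" for mu
  have S0: "S 0 = 1"
    by (simp add: S_def sum_pmf_eq_1)
  have "(S has_real_derivative expected_utility p2 U2 x1) (at 0)"
    unfolding S_def expected_utility_def
    by (rule DERIV_sum) (auto intro!: derivative_eq_intros)
  then have "((\<lambda>mu. ln (S mu)) has_real_derivative 1 / S 0 * expected_utility p2 U2 x1) (at 0)"
    by (intro DERIV_chain2[OF DERIV_ln_divide]) (auto simp: S0)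
  \<comment> \<open>Since \<open>S 0 = 1\<close>, the term \<open>ln (S 0)\<close> vanishes, so this
    quotient is the certainty equivalent itself.\<close>
  then have "((\<lambda>mu. (ln (S mu) - ln (S 0)) / (mu - 0)) \<longlongrightarrow> expected_utility p2 U2 x1) (at 0)"
    by (simp add: has_field_derivative_iff S0)
  then show ?thesis
    by (simp add: S0 certainty_equivalent_def flip: S_def)
qed

lemma gibbs_partition_nonzero:
  fixes p1 :: "'a::finite pmf"
  shows "(\<Sum>y\<in>UNIV. pmf p1 y * exp (lam * V y)) \<noteq> 0"
proof -
  obtain y where "y \<in> set_pmf p1"
    using set_pmf_not_empty[of p1] by blast
  then have "(\<Sum>y\<in>UNIV. pmf p1 y * exp (lam * V y)) > 0"
    by (intro sum_pos2[where i = y]) (auto simp: pmf_positive)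
  then show ?thesis
    by simp
qed

text \<open>For fixed \<open>lam\<close> the policy is a continuous function of finitely many
  utility values, because the partition sum never vanishes.\<close>

lemma gibbs_policy_tendsto:
  assumes "\<And>y. ((\<lambda>i. V i y) \<longlongrightarrow> V0 y) F"
  shows "((\<lambda>i. gibbs_policy p1 lam (V i) x) \<longlongrightarrow> gibbs_policy p1 lam V0 x) F"
  unfolding gibbs_policy_def by (intro tendsto_intros assms gibbs_partition_nonzero)

text \<open>The factor \<open>exp (- lam * c)\<close> is common to all weights and cancels against
  the partition sum.\<close>

lemma gibbs_policy_shift:
  "gibbs_policy p1 lam (\<lambda>y. V y - c) x = gibbs_policy p1 lam V x"
proof -
  have "pmf p1 y * exp (lam * (V y - c)) = exp (- lam * c) * (pmf p1 y * exp (lam * V y))" for y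
    by (simp add: right_diff_distrib exp_diff exp_minus field_simps)
  then show ?thesis
    unfolding gibbs_policy_def by (simp only: flip: sum_distrib_left) simp
qed

text \<open>Letting \<open>lam\<close> and \<open>V\<close> vary along one filter covers both the
  limit with fixed utility and the joint limit in both parameters.\<close>

lemma gibbs_policy_tendsto_return_pmf:
  assumes lam: "filterlim lam at_top F"
    and V: "\<And>y. ((\<lambda>i. V i y) \<longlongrightarrow> V0 y) F"
    and xs: "xs \<in> set_pmf p1"
    and less: "\<And>y. y \<in> set_pmf p1 \<Longrightarrow> y \<noteq> xs \<Longrightarrow> V0 y < V0 xs"
  shows "((\<lambda>i. gibbs_policy p1 (lam i) (V i) x) \<longlongrightarrow> pmf (return_pmf xs) x) F"
proof -
  \<comment> \<open>The shift is by the moving value \<open>V i xs\<close>, not by its limit: this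
    keeps the weight at \<open>xs\<close> constant, whereas \<open>lam i * (V i xs - V0 xs)\<close>
    need not converge.\<close>
  define w where "w i y = pmf p1 y * exp (lam i * (V i y - V i xs))" for i y
  have w: "((\<lambda>i. w i y) \<longlongrightarrow> (if y = xs then pmf p1 xs else 0)) F" for y
  proof (cases "y \<in> set_pmf p1 \<and> y \<noteq> xs")
    case True
    have "((\<lambda>i. V i y - V i xs) \<longlongrightarrow> V0 y - V0 xs) F"
      by (intro tendsto_intros V)
    moreover have "V0 y - V0 xs < 0"
      using less True by simp
    ultimately have "filterlim (\<lambda>i. (V i y - V i xs) * lam i) at_bot F"
      using lam by (rule filterlim_tendsto_neg_mult_at_bot)
    then have "((\<lambda>i. exp (lam i * (V i y - V i xs))) \<longlongrightarrow> 0) F"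
      by (intro filterlim_compose[OF exp_at_bot]) (simp add: mult.commute)
    then show ?thesis
      using True by (auto simp: w_def intro: tendsto_mult_right_zero)
  \<comment> \<open>In the remaining cases the weight is constant: \<open>pmf p1 xs\<close> at
    \<open>xs\<close>, and 0 outside the support.\<close>
  qed (auto simp: w_def set_pmf_iff)
  have pos: "pmf p1 xs \<noteq> 0"
    using xs by (simp add: set_pmf_iff)
  have "((\<lambda>i. \<Sum>y\<in>UNIV. w i y) \<longlongrightarrow> (\<Sum>y\<in>UNIV. if y = xs then pmf p1 xs else 0)) F"
    by (intro tendsto_sum w)
  then have "((\<lambda>i. 1 / (\<Sum>y\<in>UNIV. w i y) * w i x)
      \<longlongrightarrow> 1 / pmf p1 xs * (if x = xs then pmf p1 xs else 0)) F"
    by (intro tendsto_intros w) (simp_all add: pos)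
  moreover have "gibbs_policy p1 (lam i) (V i) x = 1 / (\<Sum>y\<in>UNIV. w i y) * w i x" for i
    unfolding w_def using gibbs_policy_shift[of p1 "lam i" "V i" "V i xs" x]
    by (simp add: gibbs_policy_def)
  moreover have "1 / pmf p1 xs * (if x = xs then pmf p1 xs else 0) = pmf (return_pmf xs) x"
    using pos by (simp add: indicator_def)
  ultimately show ?thesis
    by simp
qed

text \<open>\<open>arg_max\<close> is a Hilbert choice; existence of a maximizer makes it a genuine
  one, and uniqueness makes the inequality strict.\<close>

lemma unique_arg_max_less:
  fixes f :: "'a \<Rightarrow> 'b::linorder"
  assumes "\<exists>!x. is_arg_max f P x"
  shows "P (arg_max f P)" and "P y \<Longrightarrow> y \<noteq> arg_max f P \<Longrightarrow> f y < f (arg_max f P)"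
proof -
  have m: "is_arg_max f P (arg_max f P)"
    unfolding arg_max_def using assms by (metis someI_ex)
  then show "P (arg_max f P)"
    by (simp add: is_arg_max_def)
  assume "P y" "y \<noteq> arg_max f P"
  with assms m have "\<not> is_arg_max f P y"
    by blast
  with \<open>P y\<close> obtain z where "P z" "f y < f z"
    by (auto simp: is_arg_max_def)
  \<comment> \<open>The maximum is at least \<open>f z\<close>, which already exceeds
    \<open>f y\<close>.\<close>
  with m show "f y < f (arg_max f P)"
    by (meson is_arg_max_def less_le_trans not_less)
qed

theorem mainTheorem2:
  fixes p1 :: "'a::finite pmf"
    and p2 :: "'a \<Rightarrow> 'b::finite pmf"
    and U2 :: "'a \<Rightarrow> 'b \<Rightarrow> real"
  shows "(\<forall>x1. ((\<lambda>mu. certainty_equivalent p2 U2 mu x1)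
                  \<longlongrightarrow> expected_utility p2 U2 x1) (at 0)) \<and>
    (\<forall>lam x1. ((\<lambda>mu. bounded_rational_policy p1 p2 (\<lambda>_. 0) U2 lam mu x1)
                  \<longlongrightarrow> gibbs_policy p1 lam (expected_utility p2 U2) x1) (at 0)) \<and>
    (\<forall>x1s. (\<exists>!x. is_arg_max (expected_utility p2 U2) (\<lambda>y. y \<in> set_pmf p1) x) \<and>
           x1s = (ARG_MAX (expected_utility p2 U2) y. y \<in> set_pmf p1) \<longrightarrow>
       (\<forall>x1. ((\<lambda>lam. gibbs_policy p1 lam (expected_utility p2 U2) x1)
                  \<longlongrightarrow> pmf (return_pmf x1s) x1) at_top) \<and>
       (\<forall>x1. ((\<lambda>(lam, mu). bounded_rational_policy p1 p2 (\<lambda>_. 0) U2 lam mu x1)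
                  \<longlongrightarrow> pmf (return_pmf x1s) x1) (at_top \<times>\<^sub>F at 0)))"
proof (intro conjI allI impI; (elim conjE)?)
  fix x1
  show "((\<lambda>mu. certainty_equivalent p2 U2 mu x1) \<longlongrightarrow> expected_utility p2 U2 x1) (at 0)"
    by (rule certainty_equivalent_tendsto_expected_utility)
next
  fix lam x1
  show "((\<lambda>mu. bounded_rational_policy p1 p2 (\<lambda>_. 0) U2 lam mu x1)
      \<longlongrightarrow> gibbs_policy p1 lam (expected_utility p2 U2) x1) (at 0)"
    unfolding bounded_rational_policy_def
    by (intro gibbs_policy_tendsto) (simp add: certainty_equivalent_tendsto_expected_utility)
next
  fix x1s x1
  assume ex1: "\<exists>!x. is_arg_max (expected_utility p2 U2) (\<lambda>y. y \<in> set_pmf p1) x"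
    and x1s: "x1s = (ARG_MAX (expected_utility p2 U2) y. y \<in> set_pmf p1)"
  note opt = unique_arg_max_less[OF ex1, folded x1s]
  show "((\<lambda>lam. gibbs_policy p1 lam (expected_utility p2 U2) x1)
      \<longlongrightarrow> pmf (return_pmf x1s) x1) at_top"
    by (intro gibbs_policy_tendsto_return_pmf[where ?V0.0 = "expected_utility p2 U2"]
        filterlim_ident tendsto_const opt)
  \<comment> \<open>The certainty equivalent depends on the second coordinate only, so it converges
    along the product filter with no rate linking \<open>mu\<close> to \<open>lam\<close>.\<close>
  have "((\<lambda>i. certainty_equivalent p2 U2 (snd i) y) \<longlongrightarrow> expected_utility p2 U2 y)
      (at_top \<times>\<^sub>F at 0)" for y
    by (rule filterlim_compose[OF certainty_equivalent_tendsto_expected_utility filterlim_snd])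
  then show "((\<lambda>(lam, mu). bounded_rational_policy p1 p2 (\<lambda>_. 0) U2 lam mu x1)
      \<longlongrightarrow> pmf (return_pmf x1s) x1) (at_top \<times>\<^sub>F at 0)"
    unfolding bounded_rational_policy_def case_prod_beta
    by (intro gibbs_policy_tendsto_return_pmf[where ?V0.0 = "expected_utility p2 U2"]
        filterlim_fst opt) simp_all
qed

end
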